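(* Let $n,q\ge 2$ be integers. Then \begin{align*} l_{\ge q}(n)&=2l_{\ge q}(n-1,n)-l_{\ge q}(n-1)+\rho_{\ge q}(n),\\ l_{\ge q}(n-1,n)&=2l_{\ge q}(n-1)-l_{\ge q}(n-2,n-1)+\sigma_{\ge q}(n), \end{align*} where $l_{\ge q}(m)=l_{\ge q}(m,m)$, \[ \rho_{\ge q}(n)=4\sum_{i=2}^n\bigl(e_{q-1}(i)-e_q(i)\bigr), \] and so $\rho_{\ge q}(n)-\rho_{\ge q}(n-1)=4(e_{q-1}(n)-e_q(n))$, and \[ \sigma_{\ge q}(n)=(n-1)\bigl(e_{q-1}(n)-e_q(n)\bigr). \] The initial values are $l_{\ge q}(n)=l_{\ge q}(n-1,n)=0$ for all integers $n$ with $1\le n<q$, and $l_{\ge q}(q-1,q)=q-1$.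
   Context: For integers $n_1,n_2\ge 0$, let $G(n_1,n_2)=\{0,\dots,n_1-1\}\times\{0,\dots,n_2-1\}\subset\mathbb{R}^2$ (empty if $n_1=0$ or $n_2=0$). For an integer $q\ge 2$, $l_{\ge q}(n_1,n_2)$ denotes the number of lines in $\mathbb{R}^2$ passing through at least $q$ points of $G(n_1,n_2)$. For integers $n\ge 2$ and $q\ge 1$, \[ e_q(n)=\begin{cases}\phi\bigl(\frac{n-1}{q}\bigr)&\text{if } q\mid n-1,\\ 0&\text{if } q\nmid n-1,\end{cases} \] where $\phi$ is the Euler totient function. Empty sums are $0$, so $\rho_{\ge q}(1)=0$. *)

theory Defs
  imports "HOL-Analysis.Analysis" "HOL-Number_Theory.Totient"
begin

definition grid :: "nat \<Rightarrow> nat \<Rightarrow> (real \<times> real) set" where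
  "grid n1 n2 = (\<lambda>(i, j). (real i, real j)) ` ({..<n1} \<times> {..<n2})"

(* The set counted is finite for q >= 2, since two distinct points of the
   finite grid determine a line; for q < 2 it is infinite and card returns 0. *)
definition lines_ge :: "nat \<Rightarrow> nat \<Rightarrow> nat \<Rightarrow> nat" where
  "lines_ge q n1 n2 =
     card {L :: (real \<times> real) set. affine L \<and> aff_dim L = 1 \<and> card (L \<inter> grid n1 n2) \<ge> q}"

abbreviation lines_ge_sq :: "nat \<Rightarrow> nat \<Rightarrow> nat" where
  "lines_ge_sq q n \<equiv> lines_ge q n n"

(* Meaningful for n >= 2 and q >= 1. Integer-valued because differences are taken. *)
definition e_coeff :: "nat \<Rightarrow> nat \<Rightarrow> int" where
  "e_coeff q n = (if q dvd n - 1 then int (totient ((n - 1) div q)) else 0)"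

definition rho_ge :: "nat \<Rightarrow> nat \<Rightarrow> int" where
  "rho_ge q n = 4 * (\<Sum>i = 2..n. e_coeff (q - 1) i - e_coeff q i)"

definition sigma_ge :: "nat \<Rightarrow> nat \<Rightarrow> int" where
  "sigma_ge q n = (int n - 1) * (e_coeff (q - 1) n - e_coeff q n)"

end

theory Submission
  imports Defs
begin

text \<open>
  Direct every line of rational slope by its unique primitive vector \<open>v\<close> in a half plane. By convexity
  its grid points form a progression \<open>p, p + v, p + 2v, \<dots>\<close>, and a line with \<open>m\<close> grid points contains
  \<open>max 0 (m - k)\<close> pairs \<open>p, p + kv\<close>. Hence the number of lines with at least \<open>q\<close> grid points is
  \<open>F (q - 1) - F q\<close>, where \<open>F k\<close> counts the pairs \<open>(p, v)\<close> with both \<open>p\<close> and \<open>p + kv\<close> in the grid, that is,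
  \<open>F k\<close> is the sum of \<open>max 0 (n1 - k|a|) * max 0 (n2 - k|b|)\<close> over the primitive \<open>(a, b)\<close>. The mixed
  second difference of \<open>F k\<close> counts coprime pairs in a square, which gives totient sums; the
  other recurrence takes a second difference in one variable, which only leaves the \<open>b\<close> with
  \<open>kb = n - 1\<close> and thus a sum over the totatives of \<open>(n - 1) / k\<close>.
\<close>

section \<open>Lattice model of the grid, primitive directions and progressions\<close>

definition int_box :: "nat \<Rightarrow> nat \<Rightarrow> (int \<times> int) set" where
  "int_box n1 n2 = {0..<int n1} \<times> {0..<int n2}"

text \<open>The sign condition keeps exactly one of each primitive vector and its negative, so every
  rational direction occurs once.\<close>

definition dirs :: "(int \<times> int) set" where
  "dirs = {(a, b). coprime a b \<and> (a > 0 \<or> (a = 0 \<and> b > 0))}"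

text \<open>Here \<open>k\<close> counts steps, so such a progression has \<open>k + 1\<close>
  points. Only its two ends are required to lie in the box; the points between follow by
  convexity.\<close>

definition progs :: "nat \<Rightarrow> nat \<Rightarrow> nat \<Rightarrow> ((int \<times> int) \<times> (int \<times> int)) set" where
  "progs k n1 n2 = {((i, j), (a, b)).
     (i, j) \<in> int_box n1 n2 \<and> (i + int k * a, j + int k * b) \<in> int_box n1 n2 \<and> (a, b) \<in> dirs}"

definition emb :: "int \<times> int \<Rightarrow> real \<times> real" where
  "emb = (\<lambda>(i, j). (of_int i, of_int j))"

definition line :: "int \<times> int \<Rightarrow> int \<times> int \<Rightarrow> (real \<times> real) set" where
  "line p v = range (\<lambda>t. emb p + t *\<^sub>R emb v)"

lemma inj_emb: "inj emb"
  by (auto simp: inj_def emb_def)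

lemma grid_eq_int_box: "grid n1 n2 = emb ` int_box n1 n2"
proof
  show "grid n1 n2 \<subseteq> emb ` int_box n1 n2"
  proof
    fix x assume "x \<in> grid n1 n2"
    then obtain i j where "i < n1" "j < n2" "x = (real i, real j)"
      by (auto simp: grid_def)
    then have "x = emb (int i, int j)" "(int i, int j) \<in> int_box n1 n2"
      by (auto simp: emb_def int_box_def)
    then show "x \<in> emb ` int_box n1 n2" by blast
  qed
  show "emb ` int_box n1 n2 \<subseteq> grid n1 n2"
  proof
    fix x assume "x \<in> emb ` int_box n1 n2"
    then obtain i j where ij: "0 \<le> i" "i < int n1" "0 \<le> j" "j < int n2" "x = emb (i, j)"
      by (auto simp: int_box_def)
    then have "x = (\<lambda>(i, j). (real i, real j)) (nat i, nat j)" "(nat i, nat j) \<in> {..<n1} \<times> {..<n2}"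
      by (auto simp: emb_def)
    then show "x \<in> grid n1 n2" unfolding grid_def by blast
  qed
qed

text \<open>Each coordinate is monotone in the parameter, hence stays between its end values. So the
  grid points of a line have consecutive parameters.\<close>

lemma int_box_convex:
  assumes "(i + k * a, j + k * b) \<in> int_box n1 n2" "(i + m * a, j + m * b) \<in> int_box n1 n2" "k \<le> l" "l \<le> m"
  shows "(i + l * a, j + l * b) \<in> int_box n1 n2"
proof -
  have between: "0 \<le> x + l * c \<and> x + l * c < N"
    if "0 \<le> x + k * c" "x + k * c < N" "0 \<le> x + m * c" "x + m * c < N" for x c N :: int
  proof (cases "c \<ge> 0")
    case True
    then have "k * c \<le> l * c" "l * c \<le> m * c" using assms by (auto intro: mult_right_mono)
    then show ?thesis using that by linarith
  next
    case False
    then have "l * c \<le> k * c" "m * c \<le> l * c" using assms by (auto intro: mult_right_mono_neg)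
    then show ?thesis using that by linarith
  qed
  show ?thesis using assms between by (auto simp: int_box_def)
qed

section \<open>Lattice points on lines of primitive direction\<close>

lemma dirs_nonzero: "(0, 0) \<notin> dirs"
  by (simp add: dirs_def)

text \<open>The multiplier divides two coprime coordinates, so it is a unit, and the half plane
  rules out \<open>-1\<close>.\<close>

lemma dirs_unique:
  assumes "(a, b) \<in> dirs" "(c, d) \<in> dirs" "c = m * a" "d = m * b"
  shows "c = a \<and> d = b"
proof -
  have "m dvd c" "m dvd d" using assms by auto
  moreover have "coprime c d" using assms(2) by (simp add: dirs_def)
  ultimately have "is_unit m" using coprime_common_divisor by blast
  then have "m = 1 \<or> m = -1" by (simp add: zdvd1_eq abs_eq_iff')
  moreover have "m \<noteq> -1" using assms by (auto simp: dirs_def)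
  ultimately show ?thesis using assms by auto
qed

text \<open>Divide by the gcd, then reverse the sign if the quotient falls in the wrong half plane;
  hence \<open>m\<close> may be negative.\<close>

lemma ex_dir:
  fixes x y :: int
  assumes "(x, y) \<noteq> (0, 0)"
  obtains a b m where "(a, b) \<in> dirs" "m \<noteq> 0" "x = m * a" "y = m * b"
proof -
  define g where "g = gcd x y"
  have g: "g \<noteq> 0" using assms by (auto simp: g_def)
  define a b where "a = x div g" and "b = y div g"
  have x: "x = g * a" and y: "y = g * b" by (auto simp: a_def b_def g_def)
  have cop: "coprime a b" unfolding a_def b_def g_def
    using assms by (intro div_gcd_coprime) auto
  show ?thesis
  proof (cases "(a, b) \<in> dirs")
    case True
    then show ?thesis using that g x y by blast
  next
    case False
    then have "(- a, - b) \<in> dirs" using cop by (auto simp: dirs_def not_less le_less)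
    then show ?thesis using that[of "-a" "-b" "-g"] g x y by auto
  qed
qed

text \<open>With Bezout coefficients \<open>s * a + t * b = 1\<close> the factor is
  \<open>s * x + t * y\<close>.\<close>

lemma coprime_proportional:
  fixes a b x y :: int
  assumes "coprime a b" "x * b = y * a"
  obtains m where "x = m * a" "y = m * b"
proof -
  obtain s t where st: "s * a + t * b = 1"
    using assms(1) bezout_int[of a b] by auto
  have "(s * x + t * y) * a = x * (s * a + t * b)"
    using assms(2) by (simp add: algebra_simps)
  moreover have "(s * x + t * y) * b = y * (s * a + t * b)"
    using assms(2) by (simp add: algebra_simps)
  ultimately show ?thesis using that[of "s * x + t * y"] st by simp
qed

text \<open>Cross multiplication eliminates the real parameter and leaves a proportionality of
  integers; primitivity then forces an integer parameter.\<close>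

lemma emb_in_line_iff:
  assumes "(a, b) \<in> dirs"
  shows "emb (x, y) \<in> line (i, j) (a, b) \<longleftrightarrow> (\<exists>m. x = i + m * a \<and> y = j + m * b)"
proof
  assume "emb (x, y) \<in> line (i, j) (a, b)"
  then obtain t where t: "real_of_int x = of_int i + t * of_int a" "real_of_int y = of_int j + t * of_int b"
    by (auto simp: line_def emb_def)
  then have "real_of_int ((x - i) * b) = real_of_int ((y - j) * a)"
    by simp
  then have "(x - i) * b = (y - j) * a"
    by (simp only: of_int_eq_iff)
  moreover have "coprime a b" using assms by (simp add: dirs_def)
  ultimately obtain m where "x - i = m * a" "y - j = m * b"
    using coprime_proportional by metis
  then show "\<exists>m. x = i + m * a \<and> y = j + m * b" by (intro exI[of _ m]) auto
next
  assume "\<exists>m. x = i + m * a \<and> y = j + m * b"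
  then obtain m where "x = i + m * a" "y = j + m * b" by blast
  then have "emb (x, y) = emb (i, j) + of_int m *\<^sub>R emb (a, b)"
    by (simp add: emb_def)
  then show "emb (x, y) \<in> line (i, j) (a, b)" by (auto simp: line_def)
qed

lemma line_eq_affine_hull:
  "line (i, j) (a, b) = affine hull {emb (i, j), emb (i + a, j + b)}"
  by (simp add: line_def affine_hull_2_alt emb_def)

lemma affine_line:
  assumes "(a, b) \<in> dirs"
  shows "affine (line (i, j) (a, b))" "aff_dim (line (i, j) (a, b)) = 1"
proof -
  show "affine (line (i, j) (a, b))"
    by (simp add: line_eq_affine_hull)
  have "emb (i, j) \<noteq> emb (i + a, j + b)"
    using assms dirs_nonzero by (auto simp: emb_def)
  then show "aff_dim (line (i, j) (a, b)) = 1"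
    by (simp add: line_eq_affine_hull aff_dim_2)
qed

text \<open>Both lines contain the affine hull of the same two distinct points, and all three sets
  have dimension 1.\<close>

lemma affine_line_eqI:
  assumes "affine L" "aff_dim L = 1" "emb (i, j) \<in> L" "emb (i + m * a, j + m * b) \<in> L"
    and "(a, b) \<in> dirs" "m \<noteq> 0"
  shows "L = line (i, j) (a, b)"
proof -
  let ?S = "{emb (i, j), emb (i + m * a, j + m * b)}"
  have ne: "emb (i, j) \<noteq> emb (i + m * a, j + m * b)"
    using assms(5,6) dirs_nonzero by (auto simp: emb_def)
  then have d: "aff_dim (affine hull ?S) = 1" by (simp add: aff_dim_2)
  have sub: "affine hull ?S \<subseteq> T" if "affine T" "?S \<subseteq> T" for T
    using that by (simp add: hull_minimal)
  have L: "?S \<subseteq> L" using assms by simp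
  have in_line: "?S \<subseteq> line (i, j) (a, b)"
    using assms(5) by (auto simp: emb_in_line_iff intro: exI[of _ 0])
  have "affine hull ?S = L"
    by (rule affine_dim_equal) (use d L assms sub in auto)
  moreover have "affine hull ?S = line (i, j) (a, b)"
    by (rule affine_dim_equal) (use d in_line affine_line[OF assms(5)] sub in auto)
  ultimately show ?thesis by simp
qed

lemma line_inter_grid:
  assumes "(a, b) \<in> dirs"
  shows "line (i, j) (a, b) \<inter> grid n1 n2
           = (\<lambda>m. emb (i + m * a, j + m * b)) ` {m. (i + m * a, j + m * b) \<in> int_box n1 n2}"
  using assms by (auto simp: grid_eq_int_box emb_in_line_iff)

lemma inj_on_line_points:
  assumes "(a, b) \<in> dirs"
  shows "inj_on (\<lambda>m. emb (i + m * a, j + m * b)) A"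
  using assms dirs_nonzero by (intro inj_onI) (auto simp: emb_def)

lemma card_line_inter_grid:
  assumes "(a, b) \<in> dirs"
  shows "card (line (i, j) (a, b) \<inter> grid n1 n2) = card {m. (i + m * a, j + m * b) \<in> int_box n1 n2}"
  unfolding line_inter_grid[OF assms] by (rule card_image[OF inj_on_line_points[OF assms]])

lemma finite_grid: "finite (grid n1 n2)"
  by (simp add: grid_def)

lemma finite_line_params:
  assumes "(a, b) \<in> dirs"
  shows "finite {m. (i + m * a, j + m * b) \<in> int_box n1 n2}"
proof -
  have "finite ((\<lambda>m. emb (i + m * a, j + m * b)) ` {m. (i + m * a, j + m * b) \<in> int_box n1 n2})"
    unfolding line_inter_grid[OF assms, symmetric] using finite_grid by blast
  then show ?thesis by (rule finite_imageD[OF _ inj_on_line_points[OF assms]])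
qed

section \<open>Lines with at least \<open>q\<close> grid points and their first progressions\<close>

definition rich_lines :: "nat \<Rightarrow> nat \<Rightarrow> nat \<Rightarrow> (real \<times> real) set set" where
  "rich_lines q n1 n2 = {L. affine L \<and> aff_dim L = 1 \<and> card (L \<inter> grid n1 n2) \<ge> q}"

text \<open>Since the predecessor of the start lies outside the box, these are the first
  \<open>q\<close> grid points of a line in its direction: one representative per line.\<close>

definition initial_progs :: "nat \<Rightarrow> nat \<Rightarrow> nat \<Rightarrow> ((int \<times> int) \<times> (int \<times> int)) set" where
  "initial_progs q n1 n2 =
     {((i, j), (a, b)) | i j a b. ((i, j), (a, b)) \<in> progs (q - 1) n1 n2 \<and> (i - a, j - b) \<notin> int_box n1 n2}"

lemma line_of_initial_prog_rich:
  assumes "q \<ge> 1" "((i, j), (a, b)) \<in> progs (q - 1) n1 n2"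
  shows "line (i, j) (a, b) \<in> rich_lines q n1 n2"
proof -
  have D: "(a, b) \<in> dirs" and in0: "(i + 0 * a, j + 0 * b) \<in> int_box n1 n2"
    and in1: "(i + int (q - 1) * a, j + int (q - 1) * b) \<in> int_box n1 n2"
    using assms(2) by (auto simp: progs_def)
  have "{0..int (q - 1)} \<subseteq> {m. (i + m * a, j + m * b) \<in> int_box n1 n2}"
    using int_box_convex[OF in0 in1] by auto
  then have "card {0..int (q - 1)} \<le> card {m. (i + m * a, j + m * b) \<in> int_box n1 n2}"
    by (rule card_mono[OF finite_line_params[OF D]])
  then show ?thesis
    using assms(1) affine_line[OF D] by (simp add: rich_lines_def card_line_inter_grid[OF D])
qed

text \<open>Two points that differ by \<open>(c, d)\<close> lie on the first line, so
  \<open>(c, d)\<close> is an integer multiple of \<open>(a, b)\<close>.\<close>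

lemma line_eq_imp_dir_eq:
  assumes "(a, b) \<in> dirs" "(c, d) \<in> dirs" "line (i, j) (a, b) = line (k, l) (c, d)"
  shows "c = a \<and> d = b"
proof -
  have "emb (k, l) \<in> line (k, l) (c, d)" "emb (k + c, l + d) \<in> line (k, l) (c, d)"
    using assms(2) by (auto simp: emb_in_line_iff intro: exI[of _ 0] exI[of _ 1])
  then have "emb (k, l) \<in> line (i, j) (a, b)" "emb (k + c, l + d) \<in> line (i, j) (a, b)"
    using assms(3) by auto
  then obtain m m' where "k = i + m * a" "l = j + m * b" "k + c = i + m' * a" "l + d = j + m' * b"
    unfolding emb_in_line_iff[OF assms(1)] by blast
  then have "c = (m' - m) * a" "d = (m' - m) * b" by (auto simp: algebra_simps)
  then show ?thesis by (rule dirs_unique[OF assms(1,2)])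
qed

text \<open>A line determines its direction and its first grid point, which gives injectivity.
  Conversely, two grid points give a primitive direction, and the least parameter of a grid point
  gives the start.\<close>

lemma bij_betw_lines:
  assumes "q \<ge> 2"
  shows "bij_betw (\<lambda>(p, v). line p v) (initial_progs q n1 n2) (rich_lines q n1 n2)"
proof (rule bij_betw_imageI)
  show "inj_on (\<lambda>(p, v). line p v) (initial_progs q n1 n2)"
  proof (rule inj_onI)
    fix s s' assume "s \<in> initial_progs q n1 n2" "s' \<in> initial_progs q n1 n2"
      and eq: "(case s of (p, v) \<Rightarrow> line p v) = (case s' of (p, v) \<Rightarrow> line p v)"
    then obtain i j a b i' j' a' b' where s: "s = ((i, j), (a, b))" "s' = ((i', j'), (a', b'))"
      and pr: "(a, b) \<in> dirs" "(a', b') \<in> dirs"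
        "(i, j) \<in> int_box n1 n2" "(i', j') \<in> int_box n1 n2"
        "(i - a, j - b) \<notin> int_box n1 n2" "(i' - a', j' - b') \<notin> int_box n1 n2"
      unfolding initial_progs_def progs_def by blast
    have leq: "line (i, j) (a, b) = line (i', j') (a', b')" using eq s by simp
    have ab: "a' = a" "b' = b" using line_eq_imp_dir_eq[OF pr(1,2) leq] by auto
    have "emb (i', j') \<in> line (i', j') (a', b')"
      using pr(2) by (auto simp: emb_in_line_iff intro: exI[of _ 0])
    then obtain m where m: "i' = i + m * a" "j' = j + m * b"
      unfolding leq[symmetric] emb_in_line_iff[OF pr(1)] by blast
    \<comment> \<open>Otherwise the predecessor of the second start lies between the two starts,
      hence in the box. The case \<open>m < 0\<close> is symmetric.\<close>
    have "\<not> m > 0"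
    proof
      assume "m > 0"
      then have "(i + (m - 1) * a, j + (m - 1) * b) \<in> int_box n1 n2"
        using int_box_convex[of i 0 a j b n1 n2 m "m - 1"] pr(3,4) by (simp add: m)
      moreover have "i + (m - 1) * a = i' - a'" "j + (m - 1) * b = j' - b'"
        by (simp_all add: m ab left_diff_distrib)
      ultimately show False using pr(6) by (simp only:)
    qed
    moreover have "\<not> m < 0"
    proof
      assume "m < 0"
      then have "(i + (-1) * a, j + (-1) * b) \<in> int_box n1 n2"
        using int_box_convex[of i m a j b n1 n2 0 "-1"] pr(3,4) by (simp add: m)
      then show False using pr(5) by simp
    qed
    ultimately show "s = s'" using s m ab by simp
  qed
  show "(\<lambda>(p, v). line p v) ` initial_progs q n1 n2 = rich_lines q n1 n2"
  proof
    show "(\<lambda>(p, v). line p v) ` initial_progs q n1 n2 \<subseteq> rich_lines q n1 n2"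
      using assms line_of_initial_prog_rich by (auto simp: initial_progs_def)
    show "rich_lines q n1 n2 \<subseteq> (\<lambda>(p, v). line p v) ` initial_progs q n1 n2"
    proof
      fix L assume "L \<in> rich_lines q n1 n2"
      then have L: "affine L" "aff_dim L = 1" and cL: "card (L \<inter> grid n1 n2) \<ge> q"
        by (auto simp: rich_lines_def)
      then have "\<not> card (L \<inter> grid n1 n2) \<le> Suc 0" using assms by simp
      then obtain P Q where PQ: "P \<in> L \<inter> grid n1 n2" "Q \<in> L \<inter> grid n1 n2" "P \<noteq> Q"
        using finite_grid[of n1 n2] by (subst (asm) card_le_Suc0_iff_eq) auto
      then obtain i j k l where ij: "P = emb (i, j)" "(i, j) \<in> int_box n1 n2" "Q = emb (k, l)"
        by (auto simp: grid_eq_int_box)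
      then have "(k - i, l - j) \<noteq> (0, 0)" using PQ by auto
      then obtain a b m where D: "(a, b) \<in> dirs" and m: "m \<noteq> 0" "k - i = m * a" "l - j = m * b"
        by (rule ex_dir)
      then have kl: "k = i + m * a" "l = j + m * b" by auto
      have Leq: "L = line (i, j) (a, b)"
        using affine_line_eqI[OF L _ _ D m(1)] PQ ij kl by auto
      define J where "J = {m. (i + m * a, j + m * b) \<in> int_box n1 n2}"
      have fJ: "finite J" unfolding J_def by (rule finite_line_params[OF D])
      have cJ: "card J \<ge> q" using cL by (simp add: Leq card_line_inter_grid[OF D] J_def)
      then have neJ: "J \<noteq> {}" using assms by auto
      define u w where "u = Min J" and "w = Max J"
      have u: "u \<in> J" and w: "w \<in> J" using fJ neJ by (auto simp: u_def w_def)
      have "J \<subseteq> {u..w}" using fJ by (auto simp: u_def w_def)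
      then have "card J \<le> card {u..w}" by (rule card_mono[rotated]) simp
      \<comment> \<open>The interval from \<open>u\<close> to \<open>w\<close> contains at least
        \<open>q\<close> integers, so it has room for \<open>q - 1\<close> steps.\<close>
      then have uw: "u + int (q - 1) \<le> w" using cJ assms by simp
      have mid: "(i + (u + int (q - 1)) * a, j + (u + int (q - 1)) * b) \<in> int_box n1 n2"
        by (rule int_box_convex[of i u a j b _ _ w]) (use u w uw in \<open>simp_all add: J_def\<close>)
      have "u - 1 \<notin> J"
      proof
        assume "u - 1 \<in> J"
        then have "u \<le> u - 1" using fJ unfolding u_def by (intro Min_le)
        then show False by simp
      qed
      then have "(i + u * a - a, j + u * b - b) \<notin> int_box n1 n2"
        by (simp add: J_def algebra_simps)
      then have "((i + u * a, j + u * b), (a, b)) \<in> initial_progs q n1 n2"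
        using u mid D by (simp add: initial_progs_def progs_def J_def algebra_simps)
      moreover have "L = line (i + u * a, j + u * b) (a, b)"
      proof (rule affine_line_eqI[OF L _ _ D, of _ _ 1])
        show "emb (i + u * a, j + u * b) \<in> L" "emb (i + u * a + 1 * a, j + u * b + 1 * b) \<in> L"
          using D unfolding Leq
          by (auto simp: emb_in_line_iff algebra_simps intro: exI[of _ u] exI[of _ "u + 1"])
      qed simp
      ultimately show "L \<in> (\<lambda>(p, v). line p v) ` initial_progs q n1 n2" by force
    qed
  qed
qed

text \<open>The progressions of length \<open>q\<close> that extend backwards are exactly the shifts by one step of
  the progressions of length \<open>q + 1\<close>.\<close>

lemma card_progs_pred:
  assumes "q \<ge> 1" "finite (progs (q - 1) n1 n2)"
  shows "card (progs (q - 1) n1 n2) = card (initial_progs q n1 n2) + card (progs q n1 n2)"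
proof -
  define f :: "(int \<times> int) \<times> (int \<times> int) \<Rightarrow> (int \<times> int) \<times> (int \<times> int)"
    where "f = (\<lambda>((i, j), (a, b)). ((i + a, j + b), (a, b)))"
  have inj: "inj_on f A" for A by (auto simp: f_def inj_on_def)
  obtain r where r: "q = Suc r" using assms(1) by (cases q) auto
  have *: "f ((i, j), (a, b)) \<in> progs (q - 1) n1 n2 - initial_progs q n1 n2"
    if "((i, j), (a, b)) \<in> progs q n1 n2" for i j a b
  proof -
    have D: "(a, b) \<in> dirs" and in0: "(i + 0 * a, j + 0 * b) \<in> int_box n1 n2"
      and in1: "(i + int q * a, j + int q * b) \<in> int_box n1 n2"
      using that by (auto simp: progs_def)
    have "(i + 1 * a, j + 1 * b) \<in> int_box n1 n2"
      using assms by (intro int_box_convex[OF in0 in1]) auto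
    then show ?thesis using D in0 in1 r
      by (simp add: f_def progs_def initial_progs_def algebra_simps)
  qed
  have "f ` progs q n1 n2 = progs (q - 1) n1 n2 - initial_progs q n1 n2"
  proof
    show "f ` progs q n1 n2 \<subseteq> progs (q - 1) n1 n2 - initial_progs q n1 n2"
      using * by force
    show "progs (q - 1) n1 n2 - initial_progs q n1 n2 \<subseteq> f ` progs q n1 n2"
    proof
      fix s assume s: "s \<in> progs (q - 1) n1 n2 - initial_progs q n1 n2"
      obtain i j a b where sd: "s = ((i, j), (a, b))" by (metis surj_pair)
      have "((i - a, j - b), (a, b)) \<in> progs q n1 n2"
        using s r unfolding sd by (auto simp: progs_def initial_progs_def algebra_simps)
      moreover have "s = f ((i - a, j - b), (a, b))" by (simp add: f_def sd)
      ultimately show "s \<in> f ` progs q n1 n2" by blast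
    qed
  qed
  then have "card (progs q n1 n2) = card (progs (q - 1) n1 n2 - initial_progs q n1 n2)"
    using card_image[OF inj] by metis
  moreover have sub: "initial_progs q n1 n2 \<subseteq> progs (q - 1) n1 n2"
    by (auto simp: initial_progs_def)
  ultimately show ?thesis
    using card_Diff_subset[OF finite_subset[OF sub assms(2)] sub] card_mono[OF assms(2) sub] by simp
qed

section \<open>Closed formula for the number of progressions\<close>

definition coprime_pairs :: "nat \<Rightarrow> (nat \<times> nat) set" where
  "coprime_pairs N = {(a, b). a \<in> {1..N} \<and> b \<in> {1..N} \<and> coprime a b}"

text \<open>The first two terms belong to the directions \<open>(1, 0)\<close> and
  \<open>(0, 1)\<close>; the factor 2 covers both signs of \<open>b\<close>. Truncated subtraction
  plays the part of \<open>max 0\<close>, and \<open>N\<close> is a cutoff that makes the sum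
  finite.\<close>

definition prog_count :: "nat \<Rightarrow> nat \<Rightarrow> nat \<Rightarrow> nat \<Rightarrow> nat" where
  "prog_count N k n1 n2 = (n1 - k) * n2 + n1 * (n2 - k)
     + 2 * (\<Sum>(a, b)\<in>coprime_pairs N. (n1 - k * a) * (n2 - k * b))"

lemma finite_coprime_pairs: "finite (coprime_pairs N)"
  by (rule finite_subset[of _ "{1..N} \<times> {1..N}"]) (auto simp: coprime_pairs_def)

text \<open>The coordinates of the start vary independently, each over the overlap of an interval of
  length \<open>n\<close> with its translate by \<open>- k * c\<close>.\<close>

lemma card_prog_starts:
  "card {(i, j). (i, j) \<in> int_box n1 n2 \<and> (i + int k * a, j + int k * b) \<in> int_box n1 n2}
     = (n1 - k * nat \<bar>a\<bar>) * (n2 - k * nat \<bar>b\<bar>)"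
proof -
  define I where "I n c = {max 0 (- (int k * c))..<min (int n) (int n - int k * c)}" for n c
  have cI: "card (I n c) = n - k * nat \<bar>c\<bar>" for n c
  proof -
    have "int (k * nat \<bar>c\<bar>) = \<bar>int k * c\<bar>" by (simp add: abs_mult)
    then show ?thesis unfolding I_def by (simp only: card_atLeastLessThan_int)
  qed
  have "{(i, j). (i, j) \<in> int_box n1 n2 \<and> (i + int k * a, j + int k * b) \<in> int_box n1 n2} = I n1 a \<times> I n2 b"
    by (auto simp: int_box_def I_def)
  then show ?thesis by (simp add: card_cartesian_product cI)
qed

definition bounded_dirs :: "nat \<Rightarrow> (int \<times> int) set" where
  "bounded_dirs N = dirs \<inter> {- int N..int N} \<times> {- int N..int N}"

lemma finite_bounded_dirs: "finite (bounded_dirs N)"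
  by (simp add: bounded_dirs_def)

text \<open>The only primitive directions on the axes are \<open>(1, 0)\<close> and
  \<open>(0, 1)\<close>. The others have \<open>a > 0\<close> and \<open>b\<close> of either sign,
  so \<open>e 1\<close> and \<open>e (-1)\<close> cover them by two disjoint copies of the coprime
  pairs.\<close>

lemma sum_bounded_dirs:
  fixes f :: "nat \<Rightarrow> nat \<Rightarrow> nat"
  assumes "N \<ge> 1"
  shows "(\<Sum>(a, b)\<in>bounded_dirs N. f (nat \<bar>a\<bar>) (nat \<bar>b\<bar>))
           = f 1 0 + f 0 1 + 2 * (\<Sum>(a, b)\<in>coprime_pairs N. f a b)"
proof -
  define g where "g = (\<lambda>(a, b). f (nat \<bar>a\<bar>) (nat \<bar>b\<bar>))"
  define e where "e s = (\<lambda>(a, b). (int a, s * int b))" for s :: int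
  let ?C = "coprime_pairs N"
  have im: "sum g (e s ` ?C) = (\<Sum>(a, b)\<in>?C. f a b)" if "\<bar>s\<bar> = 1" for s
  proof -
    have "inj_on (e s) ?C" using that by (auto simp: inj_on_def e_def)
    then show ?thesis using that
      by (subst sum.reindex) (auto simp: g_def e_def abs_mult intro!: sum.cong)
  qed
  have fin: "finite (e s ` ?C)" for s using finite_coprime_pairs by simp
  have mem: "(a, b) \<in> e s ` ?C \<longleftrightarrow> 0 < a \<and> a \<le> int N \<and> 0 < s * b \<and> s * b \<le> int N \<and> coprime a b"
    if "\<bar>s\<bar> = 1" for a b s
  proof
    assume "(a, b) \<in> e s ` ?C"
    then show "0 < a \<and> a \<le> int N \<and> 0 < s * b \<and> s * b \<le> int N \<and> coprime a b"
      using that by (auto simp: e_def coprime_pairs_def abs_if split: if_splits)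
  next
    assume *: "0 < a \<and> a \<le> int N \<and> 0 < s * b \<and> s * b \<le> int N \<and> coprime a b"
    have s: "s = 1 \<or> s = -1" using that by auto
    have "(a, b) = e s (nat a, nat (s * b))" using * s by (auto simp: e_def)
    moreover have "(nat a, nat (s * b)) \<in> ?C"
      using * s by (auto simp: coprime_pairs_def nat_le_iff simp flip: coprime_int_iff)
    ultimately show "(a, b) \<in> e s ` ?C" by blast
  qed
  have "bounded_dirs N = {(1, 0), (0, 1)} \<union> (e 1 ` ?C \<union> e (-1) ` ?C)"
  proof (rule set_eqI)
    fix v :: "int \<times> int"
    obtain a b where v: "v = (a, b)" by force
    show "v \<in> bounded_dirs N \<longleftrightarrow> v \<in> {(1, 0), (0, 1)} \<union> (e 1 ` ?C \<union> e (-1) ` ?C)"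
      unfolding v using assms
      by (cases "b = 0"; cases "a = 0") (auto simp: mem bounded_dirs_def dirs_def)
  qed
  moreover have "{(1, 0), (0, 1)} \<inter> (e 1 ` ?C \<union> e (-1) ` ?C) = {}" "e 1 ` ?C \<inter> e (-1) ` ?C = {}"
    by (auto simp: e_def coprime_pairs_def)
  ultimately have "sum g (bounded_dirs N) = f 1 0 + f 0 1 + 2 * (\<Sum>(a, b)\<in>?C. f a b)"
    using fin by (simp add: sum.union_disjoint im) (simp add: g_def)
  then show ?thesis by (simp add: g_def)
qed

text \<open>As \<open>k \<ge> 1\<close>, a displacement \<open>k * c\<close> that fits into the grid
  forces \<open>\<bar>c\<bar> \<le> N\<close>, so bounding the directions loses nothing. The swap
  puts the direction first, so that starts are grouped by direction.\<close>

lemma progs_eq_Sigma: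
  assumes "k \<ge> 1" "n1 \<le> N" "n2 \<le> N"
  shows "progs k n1 n2 = prod.swap ` (SIGMA v:bounded_dirs N.
           {(i, j). (i, j) \<in> int_box n1 n2 \<and> (i + int k * fst v, j + int k * snd v) \<in> int_box n1 n2})"
    (is "_ = prod.swap ` ?S")
proof -
  have bd: "- int N \<le> c \<and> c \<le> int N"
    if "0 \<le> x" "x < int n" "0 \<le> x + int k * c" "x + int k * c < int n" "n \<le> N" for x c n
  proof -
    have "\<bar>c\<bar> \<le> int k * \<bar>c\<bar>" using assms(1) by (simp add: mult_le_cancel_right1)
    also have "\<dots> = \<bar>int k * c\<bar>" by (simp add: abs_mult)
    finally show ?thesis using that by linarith
  qed
  have "((i, j), (a, b)) \<in> progs k n1 n2 \<longleftrightarrow> ((a, b), (i, j)) \<in> ?S" for i j a b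
    using bd[of i n1 a] bd[of j n2 b] assms
    by (auto simp: progs_def bounded_dirs_def int_box_def)
  then show ?thesis by (force simp: image_iff)
qed

lemma card_progs:
  assumes "k \<ge> 1" "n1 \<le> N" "n2 \<le> N" "N \<ge> 1"
  shows "finite (progs k n1 n2)" "card (progs k n1 n2) = prog_count N k n1 n2"
proof -
  let ?A = "\<lambda>v. {(i, j). (i, j) \<in> int_box n1 n2 \<and> (i + int k * fst v, j + int k * snd v) \<in> int_box n1 n2}"
  have fin: "finite (?A v)" for v
    by (rule finite_subset[of _ "int_box n1 n2"]) (auto simp: int_box_def)
  show "finite (progs k n1 n2)"
    unfolding progs_eq_Sigma[OF assms(1-3)] using fin finite_bounded_dirs by blast
  have "card (progs k n1 n2) = (\<Sum>v\<in>bounded_dirs N. card (?A v))"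
    unfolding progs_eq_Sigma[OF assms(1-3)] using fin finite_bounded_dirs
    by (subst card_image) (auto simp: card_SigmaI)
  also have "\<dots> = (\<Sum>(a, b)\<in>bounded_dirs N. (n1 - k * nat \<bar>a\<bar>) * (n2 - k * nat \<bar>b\<bar>))"
    by (rule sum.cong) (auto simp: card_prog_starts)
  also have "\<dots> = prog_count N k n1 n2"
    by (subst sum_bounded_dirs[OF assms(4)]) (simp add: prog_count_def)
  finally show "card (progs k n1 n2) = prog_count N k n1 n2" .
qed

lemma lines_ge_eq_prog_count:
  assumes "q \<ge> 2" "n1 \<le> N" "n2 \<le> N" "N \<ge> 1"
  shows "int (lines_ge q n1 n2) = int (prog_count N (q - 1) n1 n2) - int (prog_count N q n1 n2)"
proof -
  have "lines_ge q n1 n2 = card (initial_progs q n1 n2)"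
    using bij_betw_same_card[OF bij_betw_lines[OF assms(1)]]
    by (simp add: lines_ge_def rich_lines_def)
  moreover have "card (progs (q - 1) n1 n2) = card (initial_progs q n1 n2) + card (progs q n1 n2)"
    using assms by (intro card_progs_pred card_progs(1)[of _ _ N]) auto
  ultimately show ?thesis using assms by (simp add: card_progs(2)[of _ _ N])
qed

lemma prog_count_commute: "prog_count N k n1 n2 = prog_count N k n2 n1"
proof -
  have "(\<Sum>(a, b)\<in>coprime_pairs N. (n1 - k * a) * (n2 - k * b))
      = (\<Sum>(a, b)\<in>coprime_pairs N. (n2 - k * a) * (n1 - k * b))"
    by (rule sum.reindex_bij_witness[of _ prod.swap prod.swap])
       (auto simp: coprime_pairs_def coprime_commute)
  then show ?thesis by (simp add: prog_count_def)
qed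

lemma prog_count_eq_0:
  assumes "n1 \<le> k" "n2 \<le> k"
  shows "prog_count N k n1 n2 = 0"
proof -
  have "(\<Sum>(a, b)\<in>coprime_pairs N. (n1 - k * a) * (n2 - k * b)) = 0"
    using assms by (intro sum.neutral) (auto simp: coprime_pairs_def intro: le_trans)
  then show ?thesis using assms by (simp add: prog_count_def)
qed

text \<open>Only the direction \<open>(0, 1)\<close> contributes: \<open>k - k * a\<close> truncates
  to 0 for \<open>a \<ge> 1\<close>. This is the source of the initial value
  \<open>q - 1\<close>.\<close>

lemma prog_count_Suc: "prog_count N k k (Suc k) = k"
proof -
  have "(\<Sum>(a, b)\<in>coprime_pairs N. (k - k * a) * (Suc k - k * b)) = 0"
    by (intro sum.neutral) (auto simp: coprime_pairs_def)
  then show ?thesis by (simp add: prog_count_def)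
qed

section \<open>Second differences as totient sums\<close>

text \<open>Cut the square along its diagonal: each half is counted by totatives, and the halves
  share only \<open>(1, 1)\<close>.\<close>

lemma card_coprime_pairs:
  assumes "M \<ge> 1"
  shows "card (coprime_pairs M) + 1 = 2 * (\<Sum>m = 1..M. totient m)"
proof -
  let ?A = "{(a, b) \<in> coprime_pairs M. b \<le> a}" and ?B = "{(a, b) \<in> coprime_pairs M. a \<le> b}"
  have "?A = (SIGMA a:{1..M}. totatives a)"
    by (auto simp: coprime_pairs_def totatives_def coprime_commute)
  then have A: "card ?A = (\<Sum>m = 1..M. totient m)"
    by (simp add: card_SigmaI totient_def)
  have "?B = prod.swap ` ?A"
    by (force simp: coprime_pairs_def coprime_commute)
  then have B: "card ?B = card ?A"
    by (simp add: card_image)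
  have "?A \<inter> ?B = {(1, 1)}"
    using assms by (auto simp: coprime_pairs_def)
  moreover have "?A \<union> ?B = coprime_pairs M" by auto
  moreover have "finite ?A" "finite ?B" using finite_coprime_pairs
    by (auto intro: finite_subset[OF _ finite_coprime_pairs])
  ultimately show ?thesis using card_Un_Int[of ?A ?B] A B by simp
qed

text \<open>The nonzero terms are those at \<open>i = k * m + 1\<close>, with value
  \<open>totient m\<close>.\<close>

lemma sum_e_coeff:
  assumes "k \<ge> 1" "n \<ge> 1"
  shows "(\<Sum>i = 2..n. e_coeff k i) = int (\<Sum>m = 1..(n - 1) div k. totient m)"
proof -
  have "(\<Sum>i = 2..n. e_coeff k i) = (\<Sum>i \<in> {i \<in> {2..n}. k dvd i - 1}. int (totient ((i - 1) div k)))"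
    by (simp add: e_coeff_def sum.If_cases Int_def)
  also have "\<dots> = (\<Sum>m = 1..(n - 1) div k. int (totient m))"
  proof (rule sum.reindex_bij_witness[of _ "\<lambda>m. k * m + 1" "\<lambda>i. (i - 1) div k"])
    fix i assume i: "i \<in> {i \<in> {2..n}. k dvd i - 1}"
    then show "k * ((i - 1) div k) + 1 = i" by auto
    have "1 \<le> (i - 1) div k"
      using i assms by (auto simp: Suc_le_eq div_greater_zero_iff intro: dvd_imp_le)
    then show "(i - 1) div k \<in> {1..(n - 1) div k}"
      using i by (auto intro: div_le_mono)
  next
    fix m assume m: "m \<in> {1..(n - 1) div k}"
    then have "k * m \<le> k * ((n - 1) div k)" by simp
    also have "\<dots> \<le> n - 1" by simp
    finally show "k * m + 1 \<in> {i \<in> {2..n}. k dvd i - 1}"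
      using m assms by auto
    show "(k * m + 1 - 1) div k = m" using assms by simp
  qed simp
  finally show ?thesis by simp
qed

lemma prog_count_mixed_difference:
  assumes "k \<ge> 1" "n \<ge> 2" "N \<ge> n"
  shows "int (prog_count N k n n) = 2 * int (prog_count N k (n - 1) n) - int (prog_count N k (n - 1) (n - 1))
           + 4 * (\<Sum>i = 2..n. e_coeff k i)"
proof -
  \<comment> \<open>The largest \<open>a\<close> with \<open>k * a \<le> n - 1\<close>, that is, the
    side of the square of coprime pairs that survives.\<close>
  define M where "M = (n - 1) div k"
  have step: "int (n - x) - int (n - 1 - x) = of_bool (x \<le> n - 1)" for x
    using assms by (auto simp: of_bool_def)
  let ?C = "coprime_pairs N"
  let ?t = "\<lambda>n1 n2 (a, b). int (n1 - k * a) * int (n2 - k * b)"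
  have F: "int (prog_count N k n1 n2) = int (n1 - k) * int n2 + int n1 * int (n2 - k) + 2 * sum (?t n1 n2) ?C" for n1 n2
    by (simp add: prog_count_def case_prod_unfold)
  have le: "k * a \<le> n - Suc 0 \<longleftrightarrow> a \<le> M" for a
    using assms by (simp add: M_def less_eq_div_iff_mult_less_eq mult.commute)
  have "M \<le> n - 1" by (simp add: M_def)
  then have MN: "M \<le> N" using assms by simp
  \<comment> \<open>The mixed second difference of a product is the product of the first
    differences, each of which is 0 or 1 by \<open>step\<close>.\<close>
  have "sum (?t n n) ?C - sum (?t (n - 1) n) ?C - sum (?t n (n - 1)) ?C + sum (?t (n - 1) (n - 1)) ?C
      = (\<Sum>(a, b)\<in>?C. of_bool (k * a \<le> n - 1) * of_bool (k * b \<le> n - 1))"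
    unfolding sum_subtractf[symmetric] sum.distrib[symmetric]
    by (rule sum.cong[OF refl], unfold split_paired_all case_prod_conv step[symmetric], algebra)
  also have "\<dots> = (\<Sum>v\<in>?C. if v \<in> coprime_pairs M then 1 else 0)"
    by (rule sum.cong) (use MN in \<open>auto simp: le coprime_pairs_def\<close>)
  also have "\<dots> = int (card (?C \<inter> coprime_pairs M))"
    by (simp add: sum.If_cases finite_coprime_pairs)
  also have "?C \<inter> coprime_pairs M = coprime_pairs M"
    using MN by (auto simp: coprime_pairs_def)
  finally have S: "sum (?t n n) ?C - sum (?t (n - 1) n) ?C - sum (?t n (n - 1)) ?C + sum (?t (n - 1) (n - 1)) ?C
      = int (card (coprime_pairs M))" .
  have n1: "int n = int (n - 1) + 1" using assms by simp
  have kn: "int (n - k) = int (n - 1 - k) + of_bool (1 \<le> M)"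
    using step[of k] le[of 1] by simp
  have "int (prog_count N k n n) - int (prog_count N k (n - 1) n) - int (prog_count N k n (n - 1))
      + int (prog_count N k (n - 1) (n - 1)) = 2 * (of_bool (1 \<le> M) + int (card (coprime_pairs M)))"
    unfolding F kn S[symmetric] by (simp add: n1 algebra_simps del: of_nat_diff)
  \<comment> \<open>The two axis directions supply exactly the \<open>+ 1\<close> of
    \<open>card_coprime_pairs\<close>. For \<open>M = 0\<close> that identity fails, but both sides
    here vanish.\<close>
  moreover have "of_bool (1 \<le> M) + int (card (coprime_pairs M)) = 2 * (\<Sum>i = 2..n. e_coeff k i)"
  proof (cases "1 \<le> M")
    case True
    then have "int (card (coprime_pairs M) + 1) = int (2 * (\<Sum>m = 1..M. totient m))"
      by (simp only: card_coprime_pairs)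
    then show ?thesis using True assms by (simp add: sum_e_coeff M_def)
  next
    case False
    then have "M = 0" by simp
    moreover have "coprime_pairs 0 = {}" by (auto simp: coprime_pairs_def)
    moreover have "(\<Sum>i = 2..n. e_coeff k i) = int (\<Sum>m = 1..M. totient m)"
      unfolding M_def using assms by (intro sum_e_coeff) auto
    ultimately show ?thesis by simp
  qed
  ultimately show ?thesis using prog_count_commute[of N k n "n - 1"] by simp
qed

text \<open>Pair \<open>a\<close> with \<open>B - a\<close>.\<close>

lemma sum_totatives_complement:
  assumes "B \<ge> 2"
  shows "2 * (\<Sum>a\<in>totatives B. B - a) = B * totient B"
proof -
  \<comment> \<open>Here \<open>B \<ge> 2\<close> matters: 1 is a totative of itself.\<close>
  have lt: "a < B" if "a \<in> totatives B" for a
    using that assms by (auto simp: totatives_def le_less)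
  have cop: "coprime (B - a) B" if a: "a \<in> totatives B" for a
  proof (rule coprimeI)
    fix c assume "c dvd B - a" "c dvd B"
    then have "c dvd a" using lt[OF a] by (auto intro: dvd_diffD1)
    moreover have "coprime a B" using a by (simp add: totatives_def)
    ultimately show "is_unit c" using \<open>c dvd B\<close> coprime_common_divisor by blast
  qed
  have comp: "B - a \<in> totatives B" if "a \<in> totatives B" for a
    using lt[OF that] cop[OF that] by (simp add: totatives_def)
  have "(\<Sum>a\<in>totatives B. B - a) = (\<Sum>a\<in>totatives B. a)"
    by (rule sum.reindex_bij_witness[of _ "\<lambda>a. B - a" "\<lambda>a. B - a"])
       (simp_all add: comp less_imp_le[OF lt])
  then have "2 * (\<Sum>a\<in>totatives B. B - a) = (\<Sum>a\<in>totatives B. (B - a) + a)"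
    by (simp add: sum.distrib)
  also have "\<dots> = (\<Sum>a\<in>totatives B. B)"
    by (rule sum.cong) (auto dest: lt)
  finally show ?thesis by (simp add: totient_def)
qed

text \<open>With the first side fixed at \<open>n - 1\<close>, only
  \<open>b = B = (n - 1) / k\<close> survives, and a totative \<open>a\<close> of \<open>B\<close>
  has weight \<open>k * (B - a)\<close>. For \<open>B \<ge> 2\<close> pairing gives half of
  \<open>(n - 1) * totient B\<close>, and the two signs of \<open>b\<close> restore the factor
  2.\<close>

lemma prog_count_side_difference:
  assumes "k \<ge> 1" "n \<ge> 2" "N \<ge> n"
  shows "int (prog_count N k (n - 1) n) = 2 * int (prog_count N k (n - 1) (n - 1))
           - int (prog_count N k (n - 2) (n - 1)) + (int n - 1) * e_coeff k n"
proof -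
  let ?C = "coprime_pairs N"
  let ?t = "\<lambda>n1 n2 (a, b). int (n1 - k * a) * int (n2 - k * b)"
  have F: "int (prog_count N k n1 n2) = int (n1 - k) * int n2 + int n1 * int (n2 - k) + 2 * sum (?t n1 n2) ?C" for n1 n2
    by (simp add: prog_count_def case_prod_unfold)
  \<comment> \<open>As a function of its first argument, truncated subtraction is piecewise linear
    with one kink, at \<open>x\<close>.\<close>
  have step: "int (n - x) - 2 * int (n - 1 - x) + int (n - 2 - x) = of_bool (x = n - 1)" for x
    using assms by (auto simp: of_bool_def)
  have "sum (?t (n - 1) n) ?C - 2 * sum (?t (n - 1) (n - 1)) ?C + sum (?t (n - 1) (n - 2)) ?C
     = (\<Sum>(a, b)\<in>?C. int (n - 1 - k * a) * of_bool (k * b = n - 1))"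
    unfolding sum_subtractf[symmetric] sum.distrib[symmetric] sum_distrib_left
    by (rule sum.cong[OF refl], unfold split_paired_all case_prod_conv step[symmetric], algebra)
  moreover have "2 * (\<Sum>(a, b)\<in>?C. int (n - 1 - k * a) * of_bool (k * b = n - 1))
      + int (n - 1) * of_bool (k = n - 1) = int (n - 1) * e_coeff k n"
  proof (cases "k dvd n - 1")
    case False
    then have "k * b \<noteq> n - 1" for b by (metis dvd_triv_left)
    then have "(\<Sum>(a, b)\<in>?C. int (n - 1 - k * a) * of_bool (k * b = n - 1)) = 0"
      by (intro sum.neutral) auto
    then show ?thesis using False by (auto simp: e_coeff_def)
  next
    case True
    then obtain B where B: "n - 1 = k * B" by auto
    then have B1: "B \<ge> 1" using assms by (cases B) auto
    have "B \<le> n - 1" using B assms by simp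
    then have BN: "B \<le> N" using assms by simp
    have "(\<Sum>(a, b)\<in>?C. int (n - 1 - k * a) * of_bool (k * b = n - 1))
        = (\<Sum>(a, b)\<in>(\<lambda>a. (a, B)) ` totatives B. int (k * (B - a)))"
    proof (rule sum.mono_neutral_cong_right)
      show "(\<lambda>a. (a, B)) ` totatives B \<subseteq> ?C"
        using BN B1 by (auto simp: coprime_pairs_def totatives_def)
      show "\<forall>v\<in>?C - (\<lambda>a. (a, B)) ` totatives B.
          (case v of (a, b) \<Rightarrow> int (n - 1 - k * a) * of_bool (k * b = n - 1)) = 0"
      proof
        fix v assume v: "v \<in> ?C - (\<lambda>a. (a, B)) ` totatives B"
        obtain a b where ab: "v = (a, b)" by force
        \<comment> \<open>In the row \<open>b = B\<close> an \<open>a\<close> coprime to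
          \<open>B\<close> that is not a totative exceeds \<open>B\<close>, so its first factor
          truncates to 0.\<close>
        have "B < a" if "b = B"
          using v that by (auto simp: ab coprime_pairs_def totatives_def image_iff)
        then have "n - 1 - k * a = 0" if "b = B" using that B by simp
        moreover have "k * b \<noteq> n - 1" if "b \<noteq> B" using that B assms by simp
        ultimately show "(case v of (a, b) \<Rightarrow> int (n - 1 - k * a) * of_bool (k * b = n - 1)) = 0"
          by (cases "b = B") (simp_all add: ab)
      qed
    qed (use B in \<open>auto simp: finite_coprime_pairs diff_mult_distrib2\<close>)
    also have "\<dots> = int (k * (\<Sum>a\<in>totatives B. B - a))"
      by (subst sum.reindex) (auto simp: inj_on_def sum_distrib_left)
    finally have S: "(\<Sum>(a, b)\<in>?C. int (n - 1 - k * a) * of_bool (k * b = n - 1))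
        = int (k * (\<Sum>a\<in>totatives B. B - a))" .
    have e: "e_coeff k n = int (totient B)" using True B assms by (simp add: e_coeff_def)
    show ?thesis
    \<comment> \<open>For \<open>B = 1\<close> the totative sum is 0, and the direction
      \<open>(0, 1)\<close> with \<open>k = n - 1\<close> supplies the whole value
      \<open>n - 1\<close>.\<close>
    proof (cases "B = 1")
      case True
      then show ?thesis unfolding S e using B by simp
    next
      case False
      then have "k * (2 * (\<Sum>a\<in>totatives B. B - a)) = k * (B * totient B)"
        using B1 by (subst sum_totatives_complement) auto
      then have "2 * (k * (\<Sum>a\<in>totatives B. B - a)) = (n - 1) * totient B"
        unfolding B by (simp only: ac_simps)
      then have "int (2 * (k * (\<Sum>a\<in>totatives B. B - a))) = int ((n - 1) * totient B)"
        by (simp only:)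
      then have "2 * int (k * (\<Sum>a\<in>totatives B. B - a)) = int (n - 1) * int (totient B)"
        by (simp only: of_nat_mult of_nat_numeral)
      moreover have "k \<noteq> n - 1" using False B assms by auto
      ultimately show ?thesis unfolding S e by simp
    qed
  qed
  \<comment> \<open>The direction \<open>(1, 0)\<close> contributes a term linear in the second
    side, so its second difference vanishes.\<close>
  moreover have "int (n - 1 - k) * (int n - 2 * int (n - 1) + int (n - 2)) = 0"
    using assms by simp
  moreover have "int (n - 1) * (int (n - k) - 2 * int (n - 1 - k) + int (n - 2 - k)) = int (n - 1) * of_bool (k = n - 1)"
    by (simp only: step)
  ultimately have "int (prog_count N k (n - 1) n) - 2 * int (prog_count N k (n - 1) (n - 1))
      + int (prog_count N k (n - 1) (n - 2)) = int (n - 1) * e_coeff k n"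
    unfolding F by (simp only: algebra_simps)
  then show ?thesis
    using assms prog_count_commute[of N k "n - 1" "n - 2"] by (simp add: of_nat_diff)
qed

section \<open>Recurrences and initial values for the line counts\<close>

theorem corollary3:
  fixes n q :: nat
  assumes "n \<ge> 2" and "q \<ge> 2"
  shows "(int (lines_ge_sq q n)
           = 2 * int (lines_ge q (n - 1) n) - int (lines_ge_sq q (n - 1)) + rho_ge q n)
     \<and> (int (lines_ge q (n - 1) n)
           = 2 * int (lines_ge_sq q (n - 1)) - int (lines_ge q (n - 2) (n - 1)) + sigma_ge q n)
     \<and> (rho_ge q n - rho_ge q (n - 1) = 4 * (e_coeff (q - 1) n - e_coeff q n))
     \<and> (\<forall>m. 1 \<le> m \<and> m < q \<longrightarrow> lines_ge_sq q m = 0 \<and> lines_ge q (m - 1) m = 0)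
     \<and> (lines_ge q (q - 1) q = q - 1)"
proof (intro conjI allI impI)
  \<comment> \<open>The common cutoff \<open>n\<close> makes all grids in the recurrences sum over
    the same coprime pairs.\<close>
  have l: "int (lines_ge q n1 n2) = int (prog_count n (q - 1) n1 n2) - int (prog_count n q n1 n2)"
    if "n1 \<le> n" "n2 \<le> n" for n1 n2
    using that assms by (intro lines_ge_eq_prog_count) auto
  have q1: "q - 1 \<ge> 1" "q \<ge> 1" using assms by auto
  show "int (lines_ge_sq q n)
      = 2 * int (lines_ge q (n - 1) n) - int (lines_ge_sq q (n - 1)) + rho_ge q n"
    using prog_count_mixed_difference[OF q1(1) assms(1) order_refl]
      prog_count_mixed_difference[OF q1(2) assms(1) order_refl]
    by (simp add: l rho_ge_def sum_subtractf algebra_simps del: of_nat_diff)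
  show "int (lines_ge q (n - 1) n)
      = 2 * int (lines_ge_sq q (n - 1)) - int (lines_ge q (n - 2) (n - 1)) + sigma_ge q n"
    using prog_count_side_difference[OF q1(1) assms(1) order_refl]
      prog_count_side_difference[OF q1(2) assms(1) order_refl]
    by (simp add: l sigma_ge_def algebra_simps del: of_nat_diff)
  obtain m where "n = Suc (Suc m)" using assms by (metis add_2_eq_Suc le_Suc_ex)
  then show "rho_ge q n - rho_ge q (n - 1) = 4 * (e_coeff (q - 1) n - e_coeff q n)"
    by (simp add: rho_ge_def algebra_simps)
next
  fix m assume m: "1 \<le> m \<and> m < q"
  \<comment> \<open>Both sides are at most \<open>m \<le> q - 1\<close>, too short for even
    \<open>q - 1\<close> steps.\<close>
  have "int (lines_ge q n1 n2) = 0" if "n1 \<le> m" "n2 \<le> m" for n1 n2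
    using that m assms by (subst lines_ge_eq_prog_count[of _ _ m]) (auto simp: prog_count_eq_0)
  then show "lines_ge_sq q m = 0" "lines_ge q (m - 1) m = 0" by auto
next
  have "prog_count q (q - 1) (q - 1) q = q - 1"
    using prog_count_Suc[of q "q - 1"] assms by simp
  moreover have "prog_count q q (q - 1) q = 0" by (rule prog_count_eq_0) auto
  moreover have "int (lines_ge q (q - 1) q) = int (prog_count q (q - 1) (q - 1) q) - int (prog_count q q (q - 1) q)"
    using assms by (intro lines_ge_eq_prog_count) auto
  ultimately show "lines_ge q (q - 1) q = q - 1" by simp
qed

end
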